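(* Let $G$ be a finite simple connected edge-transitive graph that has at least one perfect matching, and let $F(G)$ denote its maximum forcing number. Then \[\mathrm{cf}(G) \ge \frac{2|E(G)|}{|V(G)|}F(G).\]
   Context: A graph is edge-transitive if its automorphism group acts transitively on its edge set. A perfect matching of $G$ is a set of pairwise disjoint edges covering every vertex. For a perfect matching $M$, a subset $S\subseteq M$ is a forcing set of $M$ if $M$ is the unique perfect matching of $G$ containing $S$; the forcing number $f(M)$ is the minimum size of a forcing set of $M$, and $F(G)$ is the maximum of $f(M)$ over all perfect matchings $M$ of $G$. A subset $S\subseteq E(G)$ is a complete forcing set of $G$ if for every perfect matching $M$ of $G$, the set $S\cap M$ is a forcing set of $M$. The complete forcing number $\mathrm{cf}(G)$ is the minimum size of a complete forcing set of $G$. *)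

theory Defs
  imports Complex_Main
begin

text \<open>A graph is given by its vertex set and its edge set, an edge being the two-element set
  of its ends; this excludes loops and multiple edges.\<close>

definition finite_simple_graph :: "'a set \<Rightarrow> 'a set set \<Rightarrow> bool" where
  "finite_simple_graph V E \<longleftrightarrow> finite V \<and> (\<forall>e\<in>E. e \<subseteq> V \<and> card e = 2)"

text \<open>Convention: a connected graph has at least one vertex.\<close>

definition connected_graph :: "'a set \<Rightarrow> 'a set set \<Rightarrow> bool" where
  "connected_graph V E \<longleftrightarrow>
     V \<noteq> {} \<and> (\<forall>u\<in>V. \<forall>v\<in>V. (u, v) \<in> {(x, y). {x, y} \<in> E}\<^sup>*)"

text \<open>Only the values on \<open>V\<close> matter, so an automorphism of the graph is represented by any
  extension of it to the whole type.\<close>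

definition graph_automorphism :: "'a set \<Rightarrow> 'a set set \<Rightarrow> ('a \<Rightarrow> 'a) \<Rightarrow> bool" where
  "graph_automorphism V E \<phi> \<longleftrightarrow>
     bij_betw \<phi> V V \<and> (\<forall>u\<in>V. \<forall>v\<in>V. {u, v} \<in> E \<longleftrightarrow> {\<phi> u, \<phi> v} \<in> E)"

definition edge_transitive :: "'a set \<Rightarrow> 'a set set \<Rightarrow> bool" where
  "edge_transitive V E \<longleftrightarrow>
     (\<forall>e\<in>E. \<forall>f\<in>E. \<exists>\<phi>. graph_automorphism V E \<phi> \<and> \<phi> ` e = f)"

definition perfect_matching :: "'a set \<Rightarrow> 'a set set \<Rightarrow> 'a set set \<Rightarrow> bool" where
  "perfect_matching V E M \<longleftrightarrow> M \<subseteq> E \<and> pairwise disjnt M \<and> \<Union>M = V"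

definition forcing_set :: "'a set \<Rightarrow> 'a set set \<Rightarrow> 'a set set \<Rightarrow> 'a set set \<Rightarrow> bool" where
  "forcing_set V E M S \<longleftrightarrow>
     S \<subseteq> M \<and> perfect_matching V E M \<and> (\<forall>M'. perfect_matching V E M' \<and> S \<subseteq> M' \<longrightarrow> M' = M)"

text \<open>For a finite simple graph, the sets below under \<open>Min\<close> and \<open>Max\<close> are finite. They are also
  nonempty: \<open>M\<close> is a forcing set of a perfect matching \<open>M\<close>, and \<open>E\<close> is a complete forcing set;
  for \<open>max_forcing_number\<close> a perfect matching has to exist.\<close>

definition forcing_number :: "'a set \<Rightarrow> 'a set set \<Rightarrow> 'a set set \<Rightarrow> nat" where
  "forcing_number V E M = Min {card S | S. forcing_set V E M S}"

definition max_forcing_number :: "'a set \<Rightarrow> 'a set set \<Rightarrow> nat" where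
  "max_forcing_number V E = Max {forcing_number V E M | M. perfect_matching V E M}"

definition complete_forcing_set :: "'a set \<Rightarrow> 'a set set \<Rightarrow> 'a set set \<Rightarrow> bool" where
  "complete_forcing_set V E S \<longleftrightarrow>
     S \<subseteq> E \<and> (\<forall>M. perfect_matching V E M \<longrightarrow> forcing_set V E M (S \<inter> M))"

definition complete_forcing_number :: "'a set \<Rightarrow> 'a set set \<Rightarrow> nat" where
  "complete_forcing_number V E = Min {card S | S. complete_forcing_set V E S}"

end

theory Submission
  imports Defs "HOL-Combinatorics.Permutations"
begin

text \<open>Let \<open>M\<close> be a perfect matching with \<open>f(M) = F(G)\<close> and \<open>S\<close> a minimum complete forcing set.
  Every image \<open>\<phi>(S)\<close> under an automorphism is again a complete forcing set, so it meets \<open>M\<close> in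
  at least \<open>F(G)\<close> edges. By edge-transitivity the average of \<open>\<bar>\<phi>(S) \<inter> M\<bar>\<close> over all automorphisms is
  \<open>\<bar>S\<bar> \<bar>M\<bar> / \<bar>E\<bar>\<close>, and \<open>\<bar>M\<bar> = \<bar>V\<bar> / 2\<close>.\<close>

section \<open>The finite group of automorphisms and its transitivity on edges\<close>

text \<open>Automorphisms are extended by the identity outside \<open>V\<close>, so that there are finitely many.\<close>

definition automorphisms :: "'a set \<Rightarrow> 'a set set \<Rightarrow> ('a \<Rightarrow> 'a) set" where
  "automorphisms V E = {p. p permutes V \<and> (`) p ` E = E}"

lemma image_image_inv:
  assumes "bij p"
  shows "(`) p ` (`) (inv p) ` X = X" "(`) (inv p) ` (`) p ` X = X"
  using assms by (simp_all add: image_image surj_f_inv_f[OF bij_is_surj] inv_f_f[OF bij_is_inj])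

lemma automorphisms_bij: "p \<in> automorphisms V E \<Longrightarrow> bij p"
  by (auto simp: automorphisms_def permutes_bij)

lemma inj_image_automorphism: "p \<in> automorphisms V E \<Longrightarrow> inj ((`) p)"
  using inj_image_eq_iff[OF bij_is_inj[OF automorphisms_bij]] by (intro injI) blast

lemma finite_automorphisms: "finite V \<Longrightarrow> finite (automorphisms V E)"
  unfolding automorphisms_def by (rule finite_subset[OF _ finite_permutations]) auto

lemma id_in_automorphisms: "id \<in> automorphisms V E"
  by (simp add: automorphisms_def permutes_id)

lemma automorphisms_comp:
  assumes "p \<in> automorphisms V E" "q \<in> automorphisms V E"
  shows "p \<circ> q \<in> automorphisms V E"
proof -
  have "(`) (p \<circ> q) ` E = (`) p ` (`) q ` E"
    by (simp add: image_image image_comp)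
  then show ?thesis
    using assms by (simp add: automorphisms_def permutes_compose)
qed

lemma automorphisms_inv:
  assumes "p \<in> automorphisms V E"
  shows "inv p \<in> automorphisms V E"
  using assms image_image_inv(2)[OF automorphisms_bij[OF assms], of E]
  by (simp add: automorphisms_def permutes_inv)

text \<open>This passes from the maps of \<open>edge_transitive\<close>, arbitrary outside
  \<open>V\<close>, to members of a finite group. It suffices that the extension by the identity
  sends edges to edges: the induced map on the finite set \<open>E\<close> is injective, hence
  onto.\<close>

lemma graph_automorphism_extend:
  assumes G: "finite_simple_graph V E" and \<phi>: "graph_automorphism V E \<phi>"
  shows "\<exists>p\<in>automorphisms V E. \<forall>x\<in>V. p x = \<phi> x"
proof -
  define p where "p x = (if x \<in> V then \<phi> x else x)" for x
  have p_eq: "p x = \<phi> x" if "x \<in> V" for x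
    using that by (simp add: p_def)
  have "bij_betw p V V"
    using \<phi> p_eq bij_betw_cong[of V p \<phi> V] by (auto simp: graph_automorphism_def)
  then have perm: "p permutes V"
    by (rule bij_imp_permutes) (simp add: p_def)
  have "(`) p ` E \<subseteq> E"
  proof
    fix f assume "f \<in> (`) p ` E"
    then obtain e where e: "e \<in> E" "f = p ` e"
      by blast
    then obtain u v where uv: "e = {u, v}"
      using G by (meson card_2_iff finite_simple_graph_def)
    have "u \<in> V" "v \<in> V"
      using G e uv by (auto simp: finite_simple_graph_def)
    then show "f \<in> E"
      using \<phi> e uv p_eq by (auto simp: graph_automorphism_def)
  qed
  moreover have "finite E"
    using G by (auto simp: finite_simple_graph_def intro: finite_subset[of E "Pow V"])
  moreover have "inj_on ((`) p) E"
    using permutes_inj[OF perm] by (simp add: inj_on_def inj_image_eq_iff)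
  ultimately have "(`) p ` E = E"
    by (simp add: endo_inj_surj)
  then show ?thesis
    using perm p_eq by (auto simp: automorphisms_def)
qed

lemma edge_transitive_automorphisms:
  assumes G: "finite_simple_graph V E" and T: "edge_transitive V E" and e: "e \<in> E" and f: "f \<in> E"
  shows "\<exists>p\<in>automorphisms V E. p ` e = f"
proof -
  obtain \<phi> where \<phi>: "graph_automorphism V E \<phi>" "\<phi> ` e = f"
    using T e f unfolding edge_transitive_def by blast
  obtain p where "p \<in> automorphisms V E" "\<forall>x\<in>V. p x = \<phi> x"
    using graph_automorphism_extend[OF G \<phi>(1)] by blast
  moreover have "e \<subseteq> V"
    using G e by (auto simp: finite_simple_graph_def)
  ultimately show ?thesis
    using \<phi>(2) by (metis image_cong subsetD)
qed

section \<open>Invariance of matchings and forcing sets under automorphisms\<close>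

lemma perfect_matching_image:
  assumes p: "p \<in> automorphisms V E" and M: "perfect_matching V E M"
  shows "perfect_matching V E ((`) p ` M)"
proof -
  have inj: "inj p"
    using p automorphisms_bij bij_is_inj by blast
  have "(`) p ` M \<subseteq> E"
    using p M by (auto simp: perfect_matching_def automorphisms_def)
  moreover have "pairwise disjnt ((`) p ` M)"
    using M inj unfolding perfect_matching_def pairwise_image
    by (simp add: pairwise_def disjnt_def inj_image_eq_iff flip: image_Int)
  moreover have "\<Union> ((`) p ` M) = V"
    using p M by (simp add: perfect_matching_def automorphisms_def permutes_image flip: image_Union)
  ultimately show ?thesis
    by (simp add: perfect_matching_def)
qed

text \<open>A competitor \<open>M'\<close> containing the image of \<open>S\<close> is pulled back
  along \<open>inv p\<close>; there it contains \<open>S\<close>, so it is \<open>M\<close>.\<close>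

lemma forcing_set_image:
  assumes p: "p \<in> automorphisms V E" and S: "forcing_set V E M S"
  shows "forcing_set V E ((`) p ` M) ((`) p ` S)"
  unfolding forcing_set_def
proof (intro conjI allI impI)
  show "(`) p ` S \<subseteq> (`) p ` M" "perfect_matching V E ((`) p ` M)"
    using S p by (auto simp: forcing_set_def perfect_matching_image)
next
  fix M' assume M': "perfect_matching V E M' \<and> (`) p ` S \<subseteq> M'"
  let ?N = "(`) (inv p) ` M'"
  note inv = image_image_inv[OF automorphisms_bij[OF p]]
  have "perfect_matching V E ?N"
    using M' p by (simp add: perfect_matching_image automorphisms_inv)
  moreover have "S \<subseteq> ?N"
    using M' inv(2)[of S] by (metis image_mono)
  ultimately have "?N = M"
    using S by (simp add: forcing_set_def)
  then show "M' = (`) p ` M"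
    using inv(1) by metis
qed

text \<open>Testing the image of \<open>S\<close> against \<open>M\<close> amounts to testing
  \<open>S\<close> against the preimage of \<open>M\<close>, again a perfect matching, and
  transporting the result by \<open>p\<close>.\<close>

lemma complete_forcing_set_image:
  assumes p: "p \<in> automorphisms V E" and S: "complete_forcing_set V E S"
  shows "complete_forcing_set V E ((`) p ` S)"
  unfolding complete_forcing_set_def
proof (intro conjI allI impI)
  show "(`) p ` S \<subseteq> E"
    using S p by (auto simp: complete_forcing_set_def automorphisms_def)
next
  fix M assume M: "perfect_matching V E M"
  let ?N = "(`) (inv p) ` M"
  have "forcing_set V E ?N (S \<inter> ?N)"
    using S M p by (simp add: complete_forcing_set_def perfect_matching_image automorphisms_inv)
  moreover have "(`) p ` (S \<inter> ?N) = (`) p ` S \<inter> (`) p ` ?N"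
    by (intro image_Int inj_image_automorphism[OF p])
  ultimately show "forcing_set V E M ((`) p ` S \<inter> M)"
    using forcing_set_image[OF p, of ?N "S \<inter> ?N"] image_image_inv(1)[OF automorphisms_bij[OF p]]
    by metis
qed

section \<open>Double counting over the automorphism group\<close>

lemma card_perfect_matching:
  assumes "finite_simple_graph V E" "perfect_matching V E M"
  shows "card V = 2 * card M"
proof -
  have "card (\<Union>M) = (\<Sum>e\<in>M. card e)"
    using assms by (intro card_Union_disjoint)
      (auto simp: finite_simple_graph_def perfect_matching_def pairwise_def intro: finite_subset)
  also have "\<dots> = (\<Sum>e\<in>M. 2)"
    using assms by (intro sum.cong) (auto simp: finite_simple_graph_def perfect_matching_def)
  finally show ?thesis
    using assms by (simp add: perfect_matching_def)
qed

text \<open>This is orbit-stabilizer without division. The group splits into the classes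
  \<open>N g\<close>, one for each edge \<open>g\<close>. Left composition with an automorphism
  taking \<open>g\<close> to \<open>h\<close> injects \<open>N g\<close> into \<open>N h\<close>, so
  by symmetry all classes have the same size.\<close>

lemma card_automorphisms_mapping_edge:
  assumes G: "finite_simple_graph V E" and T: "edge_transitive V E" and e: "e \<in> E" and f: "f \<in> E"
  shows "card {p \<in> automorphisms V E. p ` e = f} * card E = card (automorphisms V E)"
proof -
  define N where "N g = {p \<in> automorphisms V E. p ` e = g}" for g
  have finV: "finite V" and finE: "finite E"
    using G by (auto simp: finite_simple_graph_def intro: finite_subset[of E "Pow V"])
  have fin: "finite (N g)" for g
    using finite_automorphisms[OF finV] by (simp add: N_def)
  have le: "card (N g) \<le> card (N h)" if "g \<in> E" "h \<in> E" for g h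
  proof -
    obtain q where q: "q \<in> automorphisms V E" "q ` g = h"
      using edge_transitive_automorphisms[OF G T \<open>g \<in> E\<close> \<open>h \<in> E\<close>] by blast
    have "inj_on ((\<circ>) q) (N g)"
      using bij_is_inj[OF automorphisms_bij[OF q(1)]] by (auto simp: inj_on_def fun_eq_iff)
    moreover have "(\<circ>) q ` N g \<subseteq> N h"
      using q automorphisms_comp[OF q(1)] by (auto simp: N_def image_comp[symmetric])
    ultimately show ?thesis
      using fin by (rule card_inj_on_le)
  qed
  have "automorphisms V E = (\<Union>g\<in>E. N g)"
    using e by (auto simp: N_def automorphisms_def)
  moreover have "card (\<Union>g\<in>E. N g) = (\<Sum>g\<in>E. card (N g))"
    by (intro card_UN_disjoint) (auto simp: finE fin, auto simp: N_def)
  moreover have "(\<Sum>g\<in>E. card (N g)) = (\<Sum>g\<in>E. card (N f))"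
    using le f by (intro sum.cong) (auto intro: antisym)
  ultimately show ?thesis
    by (simp add: N_def)
qed

lemma sum_card_image_Int:
  assumes G: "finite_simple_graph V E" and T: "edge_transitive V E" and S: "S \<subseteq> E" and M: "M \<subseteq> E"
  shows "(\<Sum>p\<in>automorphisms V E. card ((`) p ` S \<inter> M)) * card E
    = card S * card M * card (automorphisms V E)"
proof -
  let ?A = "automorphisms V E"
  have finV: "finite V" and finE: "finite E"
    using G by (auto simp: finite_simple_graph_def intro: finite_subset[of E "Pow V"])
  have finS: "finite S" and finM: "finite M"
    using S M finE finite_subset by blast+
  have "card ((`) p ` S \<inter> M) = (\<Sum>e\<in>S. \<Sum>f\<in>M. if p ` e = f then 1 else 0)" if "p \<in> ?A" for p
  proof -
    have inj: "inj_on ((`) p) X" for X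
      using inj_image_automorphism[OF that] inj_on_subset by blast
    \<comment> \<open>Distinct edges have distinct images, so the intersection can be counted by
      preimages in \<open>S\<close>; for each of these exactly one \<open>f\<close> in
      \<open>M\<close> contributes to the inner sum.\<close>
    have "(`) p ` S \<inter> M = (`) p ` {e \<in> S. p ` e \<in> M}"
      by blast
    then have "card ((`) p ` S \<inter> M) = card {e \<in> S. p ` e \<in> M}"
      by (simp add: card_image inj)
    also have "\<dots> = (\<Sum>e\<in>S. if p ` e \<in> M then 1 else 0)"
      using finS by (simp add: sum.If_cases Int_def)
    finally show ?thesis
      using finM by simp
  qed
  then have "(\<Sum>p\<in>?A. card ((`) p ` S \<inter> M))
      = (\<Sum>p\<in>?A. \<Sum>e\<in>S. \<Sum>f\<in>M. if p ` e = f then 1 else 0)"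
    by simp
  also have "\<dots> = (\<Sum>e\<in>S. \<Sum>p\<in>?A. \<Sum>f\<in>M. if p ` e = f then 1 else 0)"
    by (rule sum.swap)
  also have "\<dots> = (\<Sum>e\<in>S. \<Sum>f\<in>M. \<Sum>p\<in>?A. if p ` e = f then 1 else 0)"
    by (intro sum.cong refl sum.swap)
  also have "\<dots> = (\<Sum>e\<in>S. \<Sum>f\<in>M. card {p \<in> ?A. p ` e = f})"
    using finite_automorphisms[OF finV] by (simp add: sum.If_cases Int_def)
  also have "\<dots> * card E = (\<Sum>e\<in>S. \<Sum>f\<in>M. card {p \<in> ?A. p ` e = f} * card E)"
    by (simp add: sum_distrib_right)
  also have "\<dots> = (\<Sum>e\<in>S. \<Sum>f\<in>M. card ?A)"
    using S M by (intro sum.cong refl card_automorphisms_mapping_edge[OF G T]) auto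
  finally show ?thesis
    by simp
qed

section \<open>The minima and maxima in the definitions are attained\<close>

lemma forcing_number_le:
  assumes "finite M" "forcing_set V E M S"
  shows "forcing_number V E M \<le> card S"
  unfolding forcing_number_def
proof (rule Min_le)
  have "{card S | S. forcing_set V E M S} \<subseteq> card ` Pow M"
    by (auto simp: forcing_set_def)
  then show "finite {card S | S. forcing_set V E M S}"
    using assms(1) finite_subset by blast
qed (use assms(2) in blast)

lemma max_forcing_number_attained:
  assumes "finite E" "\<exists>M. perfect_matching V E M"
  shows "\<exists>M. perfect_matching V E M \<and> forcing_number V E M = max_forcing_number V E"
proof -
  let ?X = "{forcing_number V E M | M. perfect_matching V E M}"
  have "?X \<subseteq> forcing_number V E ` Pow E"
    by (auto simp: perfect_matching_def)
  then have "finite ?X"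
    using assms(1) finite_subset by blast
  then have "Max ?X \<in> ?X"
    using assms(2) by (intro Max_in) auto
  then show ?thesis
    by (auto simp: max_forcing_number_def)
qed

text \<open>This makes the set under \<open>Min\<close> nonempty. If \<open>M\<close> is contained
  in \<open>M'\<close>, a nonempty edge of \<open>M'\<close> shares a vertex with some edge of
  \<open>M\<close>, and disjointness within \<open>M'\<close> makes the two equal. An empty edge is
  excluded because adding it to a matching would change neither disjointness nor the union.\<close>

lemma complete_forcing_set_edges:
  assumes "{} \<notin> E"
  shows "complete_forcing_set V E E"
  unfolding complete_forcing_set_def forcing_set_def
proof (intro conjI allI impI)
  fix M M' assume M: "perfect_matching V E M" and M': "perfect_matching V E M' \<and> E \<inter> M \<subseteq> M'"
  have sub: "M \<subseteq> M'"
    using M M' by (auto simp: perfect_matching_def)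
  have "e \<in> M" if e: "e \<in> M'" "e \<noteq> {}" for e
  proof -
    obtain x where x: "x \<in> e"
      using e by blast
    then obtain g where g: "g \<in> M" "x \<in> g"
      using M M' e unfolding perfect_matching_def by (metis UnionE UnionI)
    then have "g = e"
      using M' sub e x unfolding perfect_matching_def pairwise_def disjnt_iff by (meson subsetD)
    then show ?thesis
      using g by simp
  qed
  moreover have "{} \<notin> M'"
    using assms M' by (auto simp: perfect_matching_def)
  ultimately show "M' = M"
    using sub by blast
qed (auto simp: perfect_matching_def)

lemma complete_forcing_number_attained:
  assumes "finite E" "{} \<notin> E"
  shows "\<exists>S. complete_forcing_set V E S \<and> card S = complete_forcing_number V E"
proof -
  let ?X = "{card S | S. complete_forcing_set V E S}"
  have "?X \<subseteq> card ` Pow E"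
    by (auto simp: complete_forcing_set_def)
  then have "finite ?X"
    using assms(1) finite_subset by blast
  then have "Min ?X \<in> ?X"
    using complete_forcing_set_edges[OF assms(2)] by (intro Min_in) auto
  then show ?thesis
    by (auto simp: complete_forcing_number_def)
qed

section \<open>Averaging over the group\<close>

theorem theorem3:
  fixes V :: "'a set" and E :: "'a set set"
  assumes "finite_simple_graph V E"
    and "connected_graph V E"
    and "edge_transitive V E"
    and "\<exists>M. perfect_matching V E M"
  shows "real (complete_forcing_number V E)
    \<ge> 2 * real (card E) / real (card V) * real (max_forcing_number V E)"
proof -
  let ?A = "automorphisms V E"
  note G = assms(1)
  have finV: "finite V" and finE: "finite E" and ne: "{} \<notin> E"
    using G by (auto simp: finite_simple_graph_def intro: finite_subset[of E "Pow V"])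
  obtain M where M: "perfect_matching V E M" "forcing_number V E M = max_forcing_number V E"
    using max_forcing_number_attained[OF finE assms(4)] by blast
  obtain S where S: "complete_forcing_set V E S" "card S = complete_forcing_number V E"
    using complete_forcing_number_attained[OF finE ne] by blast
  have ME: "M \<subseteq> E" and SE: "S \<subseteq> E"
    using M S by (auto simp: perfect_matching_def complete_forcing_set_def)
  have "max_forcing_number V E \<le> card ((`) p ` S \<inter> M)" if "p \<in> ?A" for p
    using complete_forcing_set_image[OF that S(1)] M
      forcing_number_le[OF finite_subset[OF ME finE], of V E "(`) p ` S \<inter> M"]
    by (simp add: complete_forcing_set_def)
  then have "card ?A * max_forcing_number V E \<le> (\<Sum>p\<in>?A. card ((`) p ` S \<inter> M))"
    using sum_mono[of ?A "\<lambda>_. max_forcing_number V E"] by simp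
  \<comment> \<open>Multiplying by \<open>card E\<close> makes the exact value of the sum available;
    the group order then cancels, being positive because of the identity.\<close>
  then have "card ?A * max_forcing_number V E * card E \<le> card S * card M * card ?A"
    using sum_card_image_Int[OF G assms(3) SE ME] by (metis mult_le_mono1)
  moreover have "card ?A > 0"
    using finite_automorphisms[OF finV] id_in_automorphisms by (auto simp: card_gt_0_iff)
  ultimately have "card E * max_forcing_number V E \<le> card S * card M"
    by (simp add: ac_simps)
  then have "2 * card E * max_forcing_number V E \<le> card S * card V"
    by (simp add: card_perfect_matching[OF G M(1)])
  then have "2 * real (card E) * real (max_forcing_number V E) \<le> real (card S) * real (card V)"
    by (metis (mono_tags) of_nat_le_iff of_nat_mult of_nat_numeral)
  \<comment> \<open>The convention that a connected graph has a vertex lets the denominator be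
    cleared.\<close>
  moreover have "card V > 0"
    using assms(2) finV by (auto simp: connected_graph_def card_gt_0_iff)
  ultimately show ?thesis
    by (simp add: S(2)[symmetric] field_simps)
qed

end
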